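(* Let $G$ be a wallpaper group acting on $\mathbb{C}$, containing the translations $z\mapsto z+\omega_1$ and $z\mapsto z+\omega_2$ with $\omega_1,\omega_2\neq 0$ and $\omega_1/\omega_2\notin\mathbb{R}$. Let $\Lambda=\mathbb{Z}\omega_1+\mathbb{Z}\omega_2$ and let $\wp(z)=\wp(z;\Lambda)$ be the Weierstrass elliptic function of $\Lambda$. Then every meromorphic function $f:\mathbb{C}\to\mathbb{CP}^1$ with $f(g.z)=f(z)$ for all $g\in G$ and $z\in\mathbb{C}$ is of the form $$f(z)=R(\wp(z))+S(\wp(z))\,\wp'(z),$$ where $R,S$ are rational functions with complex coefficients.
   Context: A wallpaper group is a group of rigid motions of the plane containing two non-parallel translations. It acts on $\mathbb{C}$ by $g.z=az+b$ if $g$ is sense-preserving and $g.z=a\bar z+b$ if $g$ is sense-reversing, where $|a|=1$. The Weierstrass function of a lattice $\Lambda$ is $\wp(z;\Lambda)=\frac1{z^2}+\sum_{\omega\in\Lambda\setminus\{0\}}\left(\frac1{(z-\omega)^2}-\frac1{\omega^2}\right)$. *)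

theory Defs
  imports
    "HOL-Complex_Analysis.Complex_Analysis"
    "HOL-Computational_Algebra.Polynomial"
    "HOL-Algebra.Bij"
begin

definition rigid_motion :: "(complex \<Rightarrow> complex) \<Rightarrow> bool" where
  "rigid_motion g \<longleftrightarrow> (\<exists>a b. norm a = 1 \<and> (g = (\<lambda>z. a * z + b) \<or> g = (\<lambda>z. a * cnj z + b)))"

(* Discreteness is not part of the definition. *)
definition wallpaper_group :: "(complex \<Rightarrow> complex) set \<Rightarrow> bool" where
  "wallpaper_group G \<longleftrightarrow>
     subgroup G (BijGroup UNIV) \<and> (\<forall>g\<in>G. rigid_motion g) \<and>
     (\<exists>u v. u \<noteq> 0 \<and> v \<noteq> 0 \<and> u / v \<notin> \<real> \<and> (\<lambda>z. z + u) \<in> G \<and> (\<lambda>z. z + v) \<in> G)"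

definition lattice_of :: "complex \<Rightarrow> complex \<Rightarrow> complex set" where
  "lattice_of \<omega>1 \<omega>2 = {of_int m * \<omega>1 + of_int n * \<omega>2 | m n :: int. True}"

(* The series converges absolutely for z outside the lattice, so the unordered sum is the
   usual one there; the value at lattice points, where the function has its poles, is
   meaningless. *)
definition weierstrass_p :: "complex set \<Rightarrow> complex \<Rightarrow> complex" where
  "weierstrass_p \<Lambda> z =
     1 / z ^ 2 + (\<Sum>\<^sub>\<infinity>\<omega>\<in>\<Lambda> - {0}. 1 / (z - \<omega>) ^ 2 - 1 / \<omega> ^ 2)"

(* The points of the complex projective line, as the complex plane with one point added. *)
datatype cp1 = Finite complex | Infinity

(* The map into the projective line given by a meromorphic function h whose values at
   singularities are arbitrary: it is infinite exactly at the poles, and removable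
   singularities are filled in. *)
definition cp1_map :: "(complex \<Rightarrow> complex) \<Rightarrow> complex \<Rightarrow> cp1" where
  "cp1_map h z = (if is_pole h z then Infinity else Finite (remove_sings h z))"

(* The constant map with value Infinity is excluded, as usual. *)
definition meromorphic_cp1 :: "(complex \<Rightarrow> cp1) \<Rightarrow> bool" where
  "meromorphic_cp1 f \<longleftrightarrow> (\<exists>h. h meromorphic_on UNIV \<and> f = cp1_map h)"

(* Values at zeros of Q are arbitrary; they are irrelevant under cp1_map. *)
definition rational_function :: "(complex \<Rightarrow> complex) \<Rightarrow> bool" where
  "rational_function R \<longleftrightarrow> (\<exists>P Q :: complex poly. Q \<noteq> 0 \<and> R = (\<lambda>w. poly P w / poly Q w))"

end

theory Submission
  imports Defs
begin

text \<open>
  Only the invariance under the lattice generated by \<open>\<omega>1\<close> and \<open>\<omega>2\<close> matters, so \<open>f\<close> is an elliptic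
  function. Splitting it into even and odd part and dividing the odd part by \<open>\<wp>'\<close>, it is enough to
  express an even elliptic function \<open>g\<close> rationally in \<open>\<wp>\<close>. Multiplying \<open>g\<close> by a product of powers
  of \<open>\<wp> z - \<wp> b\<close> removes its poles outside the lattice. The remaining pole at 0 has even order by
  symmetry, so it can be lowered by subtracting multiples of powers of \<open>\<wp>\<close>, until an elliptic
  function without poles is left, which is constant by Liouville's theorem.
\<close>

subsection \<open>The lattice\<close>

lemma summable_on_int_powr:
  "(\<lambda>k::int. (1 + \<bar>real_of_int k\<bar>) powr (-3/2)) summable_on UNIV"
proof -
  let ?f = "\<lambda>k::int. (1 + \<bar>real_of_int k\<bar>) powr (-3/2)"
  have "summable (\<lambda>n. real (Suc n) powr (-3/2))"
    by (subst summable_Suc_iff) (simp add: summable_real_powr_iff)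
  hence nat: "(\<lambda>n. real (Suc n) powr (-3/2)) summable_on UNIV"
    by (intro summable_nonneg_imp_summable_on) auto
  have "?f summable_on range int"
    using nat by (subst summable_on_reindex) (auto simp: o_def)
  moreover have "?f summable_on range (\<lambda>n. - int n)"
    using nat by (subst summable_on_reindex) (auto simp: o_def inj_on_def)
  moreover have "range int \<union> range (\<lambda>n. - int n) = UNIV"
    by (auto simp: image_iff) (metis int_cases2)
  ultimately show ?thesis
    using summable_on_union by metis
qed

text \<open>A product bound lets the double series split into two single ones. The exponent 3/2
  exceeds 1, so each factor is summable, and it is half of 3, so two factors together match the
  decay of an inverse cube.\<close>

lemma summable_on_int_prod_powr:
  "(\<lambda>(m, n). (1 + \<bar>real_of_int m\<bar>) powr (-3/2) * (1 + \<bar>real_of_int n\<bar>) powr (-3/2)) summable_on UNIV"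
proof -
  let ?f = "\<lambda>k::int. (1 + \<bar>real_of_int k\<bar>) powr (-3/2)"
  have "(\<lambda>(m, n). ?f m * ?f n) summable_on (UNIV \<times> UNIV)"
  proof (rule summable_on_SigmaI)
    show "((\<lambda>n. case (m, n) of (m, n) \<Rightarrow> ?f m * ?f n) has_sum ?f m * infsum ?f UNIV) UNIV" for m
      using has_sum_cmult_right[OF has_sum_infsum[OF summable_on_int_powr]] by simp
    show "(\<lambda>m. ?f m * infsum ?f UNIV) summable_on UNIV"
      using summable_on_int_powr by (rule summable_on_cmult_left)
  qed auto
  thus ?thesis by simp
qed

lemma norm_real_combination_ge:
  "\<bar>x\<bar> * \<bar>Im t\<bar> \<le> norm (of_real x * t + of_real y)"
  using abs_Im_le_cmod[of "of_real x * t + of_real y"] by (simp add: abs_mult)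

section \<open>Coordinates, discreteness and lattice sums\<close>

locale complex_lattice =
  fixes \<omega>1 \<omega>2 :: complex
  assumes ratio_not_real: "\<omega>1 / \<omega>2 \<notin> \<real>"
begin

definition \<Lambda> :: "complex set" where "\<Lambda> = lattice_of \<omega>1 \<omega>2"

lemma \<Lambda>_eq: "\<Lambda> = range (\<lambda>(m, n). of_int m * \<omega>1 + of_int n * \<omega>2)"
  by (auto simp: \<Lambda>_def lattice_of_def)

lemma periods_nonzero: "\<omega>1 \<noteq> 0" "\<omega>2 \<noteq> 0"
  \<comment> \<open>A zero period would make the quotient 0, which is real; for \<omega>2 = 0 this
    is the default value of division by zero.\<close>
  using ratio_not_real by auto

lemma Im_ratio: "Im (\<omega>1 / \<omega>2) \<noteq> 0" "Im (\<omega>2 / \<omega>1) \<noteq> 0"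
proof -
  show "Im (\<omega>1 / \<omega>2) \<noteq> 0"
    using ratio_not_real by (simp add: complex_is_Real_iff)
  have "inverse (\<omega>2 / \<omega>1) \<notin> \<real>" using ratio_not_real by simp
  hence "\<omega>2 / \<omega>1 \<notin> \<real>" using Reals_inverse by blast
  thus "Im (\<omega>2 / \<omega>1) \<noteq> 0" by (simp add: complex_is_Real_iff)
qed

lemma real_coordinates:
  obtains x y :: real where "z = of_real x * \<omega>1 + of_real y * \<omega>2"
proof -
  \<comment> \<open>After division by \<omega>2 the equation reads
    \<open>z / \<omega>2 = x * \<tau> + y\<close>: the imaginary part determines x, then the real
    part determines y.\<close>
  define \<tau> where "\<tau> = \<omega>1 / \<omega>2"
  define x where "x = Im (z / \<omega>2) / Im \<tau>"
  define y where "y = Re (z / \<omega>2) - x * Re \<tau>"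
  have "z / \<omega>2 = of_real x * \<tau> + of_real y"
    using Im_ratio(1) by (simp add: complex_eq_iff x_def y_def \<tau>_def[symmetric] del: Re_divide Im_divide)
  hence "z = of_real x * \<omega>1 + of_real y * \<omega>2"
    using periods_nonzero by (simp add: \<tau>_def field_simps)
  thus ?thesis by (rule that)
qed

text \<open>The smaller of the two heights of the period parallelogram:
  \<open>norm \<omega>2 * \<bar>Im (\<omega>1 / \<omega>2)\<bar>\<close> is the distance of
  \<omega>1 from the real line spanned by \<omega>2.\<close>

definition \<delta> :: real where
  "\<delta> = min (norm \<omega>2 * \<bar>Im (\<omega>1 / \<omega>2)\<bar>) (norm \<omega>1 * \<bar>Im (\<omega>2 / \<omega>1)\<bar>)"

lemma \<delta>_pos: "\<delta> > 0"
  using Im_ratio periods_nonzero by (simp add: \<delta>_def)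

text \<open>The point has distance \<bar>x\<bar> times one height from the line through \<omega>2
  and \<bar>y\<bar> times the other height from the line through \<omega>1; both lines pass through
  0.\<close>

lemma norm_ge_\<delta>:
  fixes x y :: real
  shows "\<delta> * max \<bar>x\<bar> \<bar>y\<bar> \<le> norm (of_real x * \<omega>1 + of_real y * \<omega>2)"
proof -
  have "\<bar>x\<bar> * \<bar>Im (\<omega>1 / \<omega>2)\<bar> \<le> norm (of_real x * (\<omega>1 / \<omega>2) + of_real y)"
    by (rule norm_real_combination_ge)
  hence "norm \<omega>2 * (\<bar>x\<bar> * \<bar>Im (\<omega>1 / \<omega>2)\<bar>) \<le> norm (\<omega>2 * (of_real x * (\<omega>1 / \<omega>2) + of_real y))"
    unfolding norm_mult by (rule mult_left_mono) simp
  also have "\<omega>2 * (of_real x * (\<omega>1 / \<omega>2) + of_real y) = of_real x * \<omega>1 + of_real y * \<omega>2"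
    using periods_nonzero by (simp add: field_simps)
  finally have 1: "norm \<omega>2 * \<bar>Im (\<omega>1 / \<omega>2)\<bar> * \<bar>x\<bar> \<le> norm (of_real x * \<omega>1 + of_real y * \<omega>2)"
    by (simp add: mult_ac)
  have "\<bar>y\<bar> * \<bar>Im (\<omega>2 / \<omega>1)\<bar> \<le> norm (of_real y * (\<omega>2 / \<omega>1) + of_real x)"
    by (rule norm_real_combination_ge)
  hence "norm \<omega>1 * (\<bar>y\<bar> * \<bar>Im (\<omega>2 / \<omega>1)\<bar>) \<le> norm (\<omega>1 * (of_real y * (\<omega>2 / \<omega>1) + of_real x))"
    unfolding norm_mult by (rule mult_left_mono) simp
  also have "\<omega>1 * (of_real y * (\<omega>2 / \<omega>1) + of_real x) = of_real x * \<omega>1 + of_real y * \<omega>2"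
    using periods_nonzero by (simp add: field_simps)
  finally have 2: "norm \<omega>1 * \<bar>Im (\<omega>2 / \<omega>1)\<bar> * \<bar>y\<bar> \<le> norm (of_real x * \<omega>1 + of_real y * \<omega>2)"
    by (simp add: mult_ac)
  have "\<delta> * \<bar>x\<bar> \<le> norm \<omega>2 * \<bar>Im (\<omega>1 / \<omega>2)\<bar> * \<bar>x\<bar>" "\<delta> * \<bar>y\<bar> \<le> norm \<omega>1 * \<bar>Im (\<omega>2 / \<omega>1)\<bar> * \<bar>y\<bar>"
    by (auto simp: \<delta>_def intro!: mult_right_mono)
  with 1 2 show ?thesis by (auto simp: max_def)
qed

lemma norm_int_ge_\<delta>:
  "\<delta> * max \<bar>real_of_int m\<bar> \<bar>real_of_int n\<bar> \<le> norm (of_int m * \<omega>1 + of_int n * \<omega>2)"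
  using norm_ge_\<delta>[of "of_int m" "of_int n"] by simp

lemma \<Lambda>_0 [simp]: "0 \<in> \<Lambda>"
  and \<Lambda>_\<omega>1: "\<omega>1 \<in> \<Lambda>" and \<Lambda>_\<omega>2: "\<omega>2 \<in> \<Lambda>"
proof -
  have *: "of_int m * \<omega>1 + of_int n * \<omega>2 \<in> \<Lambda>" for m n
    by (auto simp: \<Lambda>_eq)
  show "0 \<in> \<Lambda>" "\<omega>1 \<in> \<Lambda>" "\<omega>2 \<in> \<Lambda>"
    using *[of 0 0] *[of 1 0] *[of 0 1] by auto
qed

lemma \<Lambda>_diff: 
  assumes "a \<in> \<Lambda>" "b \<in> \<Lambda>"
  shows "a - b \<in> \<Lambda>"
proof -
  obtain m n m' n' :: int where "a = of_int m * \<omega>1 + of_int n * \<omega>2" "b = of_int m' * \<omega>1 + of_int n' * \<omega>2"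
    using assms by (auto simp: \<Lambda>_eq)
  hence "a - b = of_int (m - m') * \<omega>1 + of_int (n - n') * \<omega>2"
    by (simp add: algebra_simps)
  thus ?thesis unfolding \<Lambda>_eq by (intro image_eqI[of _ _ "(m - m', n - n')"]) auto
qed

lemma \<Lambda>_uminus: "a \<in> \<Lambda> \<Longrightarrow> - a \<in> \<Lambda>"
  using \<Lambda>_diff[of 0 a] by simp

lemma \<Lambda>_uminus_iff [simp]: "- a \<in> \<Lambda> \<longleftrightarrow> a \<in> \<Lambda>"
  using \<Lambda>_uminus[of a] \<Lambda>_uminus[of "-a"] by auto

lemma \<Lambda>_add: "a \<in> \<Lambda> \<Longrightarrow> b \<in> \<Lambda> \<Longrightarrow> a + b \<in> \<Lambda>"
  using \<Lambda>_diff[of a "-b"] by simp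

lemma \<Lambda>_add_iff: "b \<in> \<Lambda> \<Longrightarrow> a + b \<in> \<Lambda> \<longleftrightarrow> a \<in> \<Lambda>"
  using \<Lambda>_add[of a b] \<Lambda>_diff[of "a + b" b] by auto

lemma \<Lambda>_norm_ge:
  assumes "a \<in> \<Lambda>" "a \<noteq> 0"
  shows "\<delta> \<le> norm a"
proof -
  obtain m n :: int where mn: "a = of_int m * \<omega>1 + of_int n * \<omega>2"
    using assms by (auto simp: \<Lambda>_eq)
  hence "m \<noteq> 0 \<or> n \<noteq> 0" using assms by auto
  hence "1 \<le> max \<bar>real_of_int m\<bar> \<bar>real_of_int n\<bar>" by auto
  hence "\<delta> * 1 \<le> \<delta> * max \<bar>real_of_int m\<bar> \<bar>real_of_int n\<bar>"
    using \<delta>_pos by (intro mult_left_mono) auto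
  with norm_int_ge_\<delta>[of m n] mn show ?thesis by simp
qed

text \<open>Distinct lattice points are at least \<delta> apart. Arbitrary subsets are allowed
  because \<open>\<Lambda> - {0}\<close> is needed as well as \<Lambda>.\<close>

lemma \<Lambda>_closed:
  assumes "A \<subseteq> \<Lambda>"
  shows "closed A"
proof (rule discrete_imp_closed[OF \<delta>_pos], intro ballI impI)
  fix x y assume "x \<in> A" "y \<in> A" "dist y x < \<delta>"
  thus "y = x"
    using assms \<Lambda>_norm_ge[OF \<Lambda>_diff, of y x] by (force simp: dist_norm)
qed

lemma \<Lambda>_not_islimpt: "\<not> z islimpt \<Lambda>"
proof
  assume z: "z islimpt \<Lambda>"
  hence "z \<in> \<Lambda>" using \<Lambda>_closed[of \<Lambda>] closed_limpt by blast
  moreover obtain y where "y \<in> \<Lambda>" "y \<noteq> z" "dist y z < \<delta>"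
    using z \<delta>_pos unfolding islimpt_approachable by blast
  ultimately show False
    using \<Lambda>_norm_ge[OF \<Lambda>_diff, of y z] by (simp add: dist_norm)
qed

lemma eventually_not_in_\<Lambda>: "eventually (\<lambda>w. w \<notin> \<Lambda>) (at z)"
  using \<Lambda>_not_islimpt[of z] by (simp add: islimpt_iff_eventually)

lemma \<Lambda>_countable: "countable \<Lambda>"
  by (auto simp: \<Lambda>_eq)

text \<open>The majorant for the Weierstrass series. With M the larger of \<bar>m\<bar> and
  \<bar>n\<bar>, the norm is at least \<delta> * M, and M ^ (-3) is dominated by the product series.
  The origin may stay in the index set, since its term is 1 / 0 = 0.\<close>

lemma summable_inverse_cube: "(\<lambda>\<omega>. 1 / norm \<omega> ^ 3) summable_on \<Lambda>"
proof -
  let ?h = "\<lambda>(m::int, n::int). of_int m * \<omega>1 + of_int n * \<omega>2"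
  let ?a = "\<lambda>k::int. (1 + \<bar>real_of_int k\<bar>) powr (-3/2)"
  have inj: "inj ?h"
  proof (rule injI, clarify)
    fix m n m' n' :: int
    assume "of_int m * \<omega>1 + of_int n * \<omega>2 = of_int m' * \<omega>1 + of_int n' * \<omega>2"
    hence "norm (of_int (m - m') * \<omega>1 + of_int (n - n') * \<omega>2) = 0"
      by (simp add: algebra_simps)
    with norm_int_ge_\<delta>[of "m - m'" "n - n'"] \<delta>_pos
    have "max \<bar>real_of_int (m - m')\<bar> \<bar>real_of_int (n - n')\<bar> \<le> 0"
      by (simp add: mult_le_0_iff)
    thus "m = m' \<and> n = n'" by auto
  qed
  have bound: "1 / norm (?h (m, n)) ^ 3 \<le> 8 / \<delta> ^ 3 * (?a m * ?a n)" for m n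
  proof (cases "m = 0 \<and> n = 0")
    case True
    thus ?thesis using \<delta>_pos by simp
  next
    case False
    define M where "M = max \<bar>real_of_int m\<bar> \<bar>real_of_int n\<bar>"
    have M1: "M \<ge> 1" using False by (auto simp: M_def)
    have le: "1 + \<bar>real_of_int m\<bar> \<le> 2 * M" "1 + \<bar>real_of_int n\<bar> \<le> 2 * M"
      using M1 by (auto simp: M_def)
    \<comment> \<open>Both \<open>1 + \<bar>m\<bar>\<close> and \<open>1 + \<bar>n\<bar>\<close> are
      at most 2 * M because M is at least 1; cubing 2 * M is the origin of the constant 8.\<close>
    have "(2 * M) powr (-3/2) * (2 * M) powr (-3/2) \<le> ?a m * ?a n"
      using le M1 by (intro mult_mono powr_mono2') auto
    also have "(2 * M) powr (-3/2) * (2 * M) powr (-3/2) = 1 / (8 * M ^ 3)"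
      using M1 by (simp add: powr_add[symmetric] powr_minus powr_numeral field_simps power_mult_distrib)
    finally have *: "1 / (8 * M ^ 3) \<le> ?a m * ?a n" .
    have "(\<delta> * M) ^ 3 \<le> norm (?h (m, n)) ^ 3"
      using norm_int_ge_\<delta>[of m n] \<delta>_pos M1 by (intro power_mono) (auto simp: M_def[symmetric])
    hence "1 / norm (?h (m, n)) ^ 3 \<le> 1 / (\<delta> * M) ^ 3"
      using \<delta>_pos M1 by (intro frac_le) simp_all
    also have "\<dots> = 8 / \<delta> ^ 3 * (1 / (8 * M ^ 3))"
      using M1 \<delta>_pos by (simp add: field_simps)
    also have "\<dots> \<le> 8 / \<delta> ^ 3 * (?a m * ?a n)"
      using * \<delta>_pos by (intro mult_left_mono) auto
    finally show ?thesis .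
  qed
  have "(\<lambda>\<omega>. 1 / norm (?h \<omega>) ^ 3) summable_on UNIV"
  proof (rule summable_on_comparison_test)
    show "(\<lambda>\<omega>. 8 / \<delta> ^ 3 * (case \<omega> of (m, n) \<Rightarrow> ?a m * ?a n)) summable_on UNIV"
      using summable_on_int_prod_powr by (rule summable_on_cmult_right)
    show "1 / norm (?h \<omega>) ^ 3 \<le> 8 / \<delta> ^ 3 * (case \<omega> of (m, n) \<Rightarrow> ?a m * ?a n)" for \<omega>
      using bound[of "fst \<omega>" "snd \<omega>"] by (simp add: case_prod_unfold)
  qed auto
  thus ?thesis
    unfolding \<Lambda>_eq by (subst summable_on_reindex[OF inj]) (simp add: o_def)
qed

end

subsection \<open>The Weierstrass function\<close>

lemma inverse_square_derivative:
  fixes w a c :: complex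
  assumes "w \<noteq> a"
  shows "((\<lambda>w. 1 / (w - a) ^ 2 - c) has_field_derivative -2 / (w - a) ^ 3) (at w)"
proof -
  have *: "- (2 * u) / (u ^ 2 * u ^ 2) = - 2 / u ^ 3" if "u \<noteq> 0" for u :: complex
    using that by (simp add: field_simps power2_eq_square power3_eq_cube)
  show ?thesis
    by (rule derivative_eq_intros refl | use assms *[of "w - a"] in simp)+
qed

context complex_lattice begin


lemma \<Lambda>_separated:
  assumes "A \<subseteq> \<Lambda>" "z \<notin> A"
  obtains e where "e > 0" "\<And>w a. w \<in> cball z e \<Longrightarrow> a \<in> A \<Longrightarrow> e \<le> norm (w - a)"
proof -
  obtain d where d: "d > 0" "\<And>a. a \<in> A \<Longrightarrow> d \<le> dist z a"
    using separate_point_closed[OF \<Lambda>_closed[OF assms(1)] assms(2)] by blast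
  show ?thesis
  \<comment> \<open>Half the distance from z to A works both as radius and as separation, by the
    triangle inequality.\<close>
  proof (rule that[of "d / 2"])
    fix w a assume "w \<in> cball z (d / 2)" "a \<in> A"
    thus "d / 2 \<le> norm (w - a)"
      using d(2)[of a] dist_triangle[of z a w] by (simp add: dist_norm[of w a])
  qed (use d in auto)
qed

text \<open>The difference equals \<open>z * (2 * a - z) / ((z - a) ^ 2 * a ^ 2)\<close>, which is
  of order -3 in a. One M serves all z of norm at most r that keep distance d from a, as the
  Weierstrass M-test requires.\<close>

lemma term_bound:
  assumes "r \<ge> 0" "d > 0"
  shows "\<exists>M. \<forall>z a. norm z \<le> r \<longrightarrow> a \<in> \<Lambda> - {0} \<longrightarrow> d \<le> norm (z - a) \<longrightarrow>
           norm (1 / (z - a) ^ 2 - 1 / a ^ 2) \<le> M * (1 / norm a ^ 3)"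
proof -
  \<comment> \<open>From \<open>norm a \<le> norm (z - a) + r\<close> and
    \<open>d \<le> norm (z - a)\<close> one gets
    \<open>norm a \<le> (1 + r / d) * norm (z - a)\<close>, and c is the inverse of that factor. In
    M, the factor \<open>2 + r / \<delta>\<close> bounds \<open>norm (2 * a - z) / norm a\<close>,
    using \<open>norm a \<ge> \<delta>\<close>.\<close>
  define c where "c = d / (d + r)"
  have c: "c > 0" using assms by (simp add: c_def)
  define M where "M = r * (2 + r / \<delta>) / c ^ 2"
  have far: "c * norm a \<le> norm (z - a)" if "norm z \<le> r" "d \<le> norm (z - a)" for z a
  proof -
    have "norm a \<le> norm (z - a) + norm z"
      by (metis add.commute norm_minus_commute norm_triangle_sub)
    also have "\<dots> \<le> norm (z - a) + r * (norm (z - a) / d)"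
    proof -
      have "r * 1 \<le> r * (norm (z - a) / d)"
        using that assms by (intro mult_left_mono) (auto simp: field_simps)
      thus ?thesis using that by linarith
    qed
    also have "\<dots> = norm (z - a) / c"
      using assms by (simp add: c_def field_simps)
    finally show ?thesis using c by (simp add: field_simps)
  qed
  show ?thesis
  proof (intro exI[of _ M] allI impI)
    fix z a assume *: "norm z \<le> r" "a \<in> \<Lambda> - {0}" "d \<le> norm (z - a)"
    have a: "norm a > 0" "\<delta> \<le> norm a" using * \<Lambda>_norm_ge[of a] by auto
    have za: "norm (z - a) > 0" "c * norm a \<le> norm (z - a)" using * assms far by auto
    have "norm (2 * a - z) \<le> 2 * norm a + r"
      using norm_triangle_ineq4[of "2 * a" z] * by simp
    also have "\<dots> \<le> 2 * norm a + r * (norm a / \<delta>)"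
      using a assms \<delta>_pos mult_left_mono[of 1 "norm a / \<delta>" r] by simp
    also have "\<dots> = (2 + r / \<delta>) * norm a" by (simp add: field_simps)
    finally have num: "norm z * norm (2 * a - z) \<le> r * ((2 + r / \<delta>) * norm a)"
      using * assms by (intro mult_mono) auto
    have "1 / (z - a) ^ 2 - 1 / a ^ 2 = z * (2 * a - z) / ((z - a) ^ 2 * a ^ 2)"
    proof -
      have *: "1 / u ^ 2 - 1 / a ^ 2 = (u + a) * (a - u) / (u ^ 2 * a ^ 2)" if "u \<noteq> 0" for u
        using that a by (simp add: field_simps power2_eq_square)
      show ?thesis using *[of "z - a"] za by (simp add: algebra_simps)
    qed
    hence "norm (1 / (z - a) ^ 2 - 1 / a ^ 2)
        = norm z * norm (2 * a - z) / (norm (z - a) ^ 2 * norm a ^ 2)"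
      by (simp add: norm_mult norm_divide norm_power)
    also have "\<dots> \<le> r * ((2 + r / \<delta>) * norm a) / ((c * norm a) ^ 2 * norm a ^ 2)"
      using num a za c assms \<delta>_pos
      by (intro frac_le mult_right_mono power_mono) auto
    also have "\<dots> = M * (1 / norm a ^ 3)"
      using a c by (simp add: M_def field_simps power2_eq_square power3_eq_cube)
    finally show "norm (1 / (z - a) ^ 2 - 1 / a ^ 2) \<le> M * (1 / norm a ^ 3)" .
  qed
qed

section \<open>The series and its derivative\<close>

definition wp :: "complex \<Rightarrow> complex" where "wp = weierstrass_p \<Lambda>"

text \<open>Splitting off 1 / z ^ 2 isolates the pole at 0; what remains is holomorphic
  there.\<close>

definition wp_reg :: "complex \<Rightarrow> complex" where
  "wp_reg z = (\<Sum>\<^sub>\<infinity>\<omega>\<in>\<Lambda> - {0}. 1 / (z - \<omega>) ^ 2 - 1 / \<omega> ^ 2)"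

lemma wp_eq: "wp z = 1 / z ^ 2 + wp_reg z"
  by (simp add: wp_def weierstrass_p_def wp_reg_def)

text \<open>By the M-test the finite partial sums converge uniformly on a closed ball around z, so
  the limit may be differentiated term by term; the same theorem yields convergence of the
  differentiated series. Limits run along \<open>finite_subsets_at_top\<close>, the filter behind
  \<open>has_sum\<close>.\<close>

lemma wp_reg_derivative:
  assumes z: "z \<notin> \<Lambda> - {0}"
  obtains D where "(wp_reg has_field_derivative D) (at z)"
    "((\<lambda>\<omega>. -2 / (z - \<omega>) ^ 3) has_sum D) (\<Lambda> - {0})"
proof -
  let ?L = "\<Lambda> - {0}"
  obtain e where e: "e > 0" "\<And>w a. w \<in> cball z e \<Longrightarrow> a \<in> ?L \<Longrightarrow> e \<le> norm (w - a)"
    using \<Lambda>_separated[of ?L z] z by blast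
  have "norm z + e \<ge> 0" using e(1) by simp
  then obtain M where M: "\<And>w a. \<lbrakk>norm w \<le> norm z + e; a \<in> ?L; e \<le> norm (w - a)\<rbrakk> \<Longrightarrow>
       norm (1 / (w - a) ^ 2 - 1 / a ^ 2) \<le> M * (1 / norm a ^ 3)"
    using term_bound[of "norm z + e" e] e(1) by blast
  let ?F = "finite_subsets_at_top ?L"
  let ?f = "\<lambda>X w. \<Sum>\<omega>\<in>X. 1 / (w - \<omega>) ^ 2 - 1 / \<omega> ^ 2"
  let ?f' = "\<lambda>X w. \<Sum>\<omega>\<in>X. -2 / (w - \<omega>) ^ 3"
  have D: "(?f X has_field_derivative ?f' X w) (at w)" if "X \<subseteq> ?L" "w \<in> cball z e" for X w
  proof -
    have "w - \<omega> \<noteq> 0" if "\<omega> \<in> X" for \<omega>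
    proof -
      have "e \<le> norm (w - \<omega>)"
        using that \<open>X \<subseteq> ?L\<close> \<open>w \<in> cball z e\<close> by (intro e(2)) auto
      thus ?thesis using e(1) by auto
    qed
    thus ?thesis by (intro DERIV_sum inverse_square_derivative) auto
  qed
  have 1: "eventually (\<lambda>X. continuous_on (cball z e) (?f X) \<and>
      (\<forall>w\<in>ball z e. (?f X has_field_derivative ?f' X w) (at w))) ?F"
  proof (rule eventually_finite_subsets_at_top_weakI)
    fix X assume "X \<subseteq> ?L"
    hence "continuous_on (cball z e) (?f X)"
      using D by (intro continuous_at_imp_continuous_on ballI DERIV_isCont) blast
    thus "continuous_on (cball z e) (?f X) \<and>
      (\<forall>w\<in>ball z e. (?f X has_field_derivative ?f' X w) (at w))"
      using D \<open>X \<subseteq> ?L\<close> by auto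
  qed
  have "(\<lambda>\<omega>. 1 / norm \<omega> ^ 3) summable_on ?L"
    using summable_inverse_cube by (rule summable_on_subset) auto
  hence "(\<lambda>\<omega>. M * (1 / norm \<omega> ^ 3)) summable_on ?L"
    by (rule summable_on_cmult_right)
  hence 2: "uniform_limit (cball z e) ?f wp_reg ?F"
    unfolding wp_reg_def
  proof (intro Weierstrass_m_test_general[rotated])
    fix a w assume "a \<in> ?L" "w \<in> cball z e"
    moreover from this have "norm w \<le> norm z + e"
      using norm_triangle_sub[of w z] by (simp add: dist_norm norm_minus_commute)
    ultimately show "norm (1 / (w - a) ^ 2 - 1 / a ^ 2) \<le> M * (1 / norm a ^ 3)"
      using M e by blast
  qed
  obtain g' where "(wp_reg has_field_derivative g' z) (at z)" "((\<lambda>X. ?f' X z) \<longlongrightarrow> g' z) ?F"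
    using has_complex_derivative_uniform_limit[OF 1 2] e(1) by (metis centre_in_ball finite_subsets_at_top_neq_bot)
  thus ?thesis by (intro that) (auto simp: has_sum_def)
qed

lemma wp_reg_holomorphic: "wp_reg holomorphic_on - (\<Lambda> - {0})"
  by (rule holomorphic_onI) 
     (metis ComplD field_differentiable_at_within field_differentiable_def wp_reg_derivative)

lemma wp_reg_analytic_at_0: "wp_reg analytic_on {0}"
  using wp_reg_holomorphic \<Lambda>_closed[of "\<Lambda> - {0}"] by (auto simp: analytic_at open_Compl)

text \<open>The index 0 accounts for the derivative of 1 / z ^ 2. A sum over the whole lattice is
  invariant under lattice translations by reindexing, which the series for \<wp> itself does not
  show.\<close>

definition wp_deriv :: "complex \<Rightarrow> complex" where
  "wp_deriv z = (\<Sum>\<^sub>\<infinity>\<omega>\<in>\<Lambda>. -2 / (z - \<omega>) ^ 3)"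

lemma wp_has_derivative:
  assumes "z \<notin> \<Lambda>"
  shows "(wp has_field_derivative wp_deriv z) (at z)"
proof -
  have z: "z \<noteq> 0" "z \<notin> \<Lambda> - {0}" using assms by auto
  obtain D where D: "(wp_reg has_field_derivative D) (at z)"
      "((\<lambda>\<omega>. -2 / (z - \<omega>) ^ 3) has_sum D) (\<Lambda> - {0})"
    using wp_reg_derivative[OF z(2)] .
  have "((\<lambda>\<omega>. -2 / (z - \<omega>) ^ 3) has_sum (-2 / (z - 0) ^ 3 + D)) (insert 0 (\<Lambda> - {0}))"
    using D(2) by (intro has_sum_insert) auto
  hence "wp_deriv z = -2 / z ^ 3 + D"
    by (simp add: wp_deriv_def insert_absorb infsumI)
  moreover have "((\<lambda>z. 1 / z ^ 2 + wp_reg z) has_field_derivative (-2 / z ^ 3 + D)) (at z)"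
    using z(1) by (auto intro!: derivative_eq_intros D(1) simp: field_simps power2_eq_square power3_eq_cube)
  ultimately show ?thesis by (simp add: wp_eq[abs_def])
qed

section \<open>Periodicity and parity\<close>

lemma wp_deriv_periodic:
  assumes "a \<in> \<Lambda>"
  shows "wp_deriv (z + a) = wp_deriv z"
  unfolding wp_deriv_def
  by (rule infsum_reindex_bij_witness[of _ "\<lambda>x. x + a" "\<lambda>x. x - a"])
     (use assms in \<open>auto simp: \<Lambda>_diff \<Lambda>_add algebra_simps\<close>)

lemma wp_even: "wp (- z) = wp z"
proof -
  have "(\<Sum>\<^sub>\<infinity>\<omega>\<in>\<Lambda> - {0}. 1 / (- z - \<omega>) ^ 2 - 1 / \<omega> ^ 2) =
        (\<Sum>\<^sub>\<infinity>\<omega>\<in>\<Lambda> - {0}. 1 / (z - \<omega>) ^ 2 - 1 / \<omega> ^ 2)"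
  proof (rule infsum_reindex_bij_witness[of _ uminus uminus])
    fix a :: complex
    have "(- z - - a)\<^sup>2 = (z - a)\<^sup>2" by (simp add: power2_commute)
    show "1 / (z - (- a))\<^sup>2 - 1 / (- a)\<^sup>2 = 1 / (- z - a)\<^sup>2 - 1 / a\<^sup>2"
      by (metis (no_types, opaque_lifting) diff_minus_eq_add minus_diff_eq power2_minus uminus_add_conv_diff add.commute)
  qed auto
  thus ?thesis by (simp add: wp_def weierstrass_p_def)
qed

text \<open>Half periods are the points at which the integration constant in the proof of
  periodicity is evaluated, so they must avoid the poles.\<close>

lemma half_period_notin: "\<omega>1 / 2 \<notin> \<Lambda>" "\<omega>2 / 2 \<notin> \<Lambda>"
proof -
  have *: "of_real x * \<omega>1 + of_real y * \<omega>2 \<notin> \<Lambda>" if "x \<notin> \<int> \<or> y \<notin> \<int>" for x y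
  proof
    assume "of_real x * \<omega>1 + of_real y * \<omega>2 \<in> \<Lambda>"
    then obtain m n :: int where "of_real x * \<omega>1 + of_real y * \<omega>2 = of_int m * \<omega>1 + of_int n * \<omega>2"
      by (auto simp: \<Lambda>_eq)
    hence "norm (of_real (x - of_int m) * \<omega>1 + of_real (y - of_int n) * \<omega>2) = 0"
      by (simp add: algebra_simps)
    with norm_ge_\<delta>[of "x - of_int m" "y - of_int n"] \<delta>_pos
    have "max \<bar>x - of_int m\<bar> \<bar>y - of_int n\<bar> \<le> 0" by (simp add: mult_le_0_iff)
    hence "x = of_int m" "y = of_int n" by auto
    with that show False by auto
  qed
  have "(1/2 :: real) \<notin> \<int>"
  proof
    assume "(1/2 :: real) \<in> \<int>"
    then obtain k :: int where "1/2 = real_of_int k" by (auto elim: Ints_cases)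
    hence "real_of_int (2 * k) = real_of_int 1" by simp
    hence "2 * k = 1" by (simp only: of_int_eq_iff)
    thus False by presburger
  qed
  thus "\<omega>1 / 2 \<notin> \<Lambda>" "\<omega>2 / 2 \<notin> \<Lambda>"
    using *[of "1/2" 0] *[of 0 "1/2"] by auto
qed

text \<open>The derivative is periodic, so \<open>wp (z + a) - wp z\<close> is constant on the
  complement of \<Lambda>, which is connected because \<Lambda> is countable. At z = -a / 2 evenness
  makes the constant 0.\<close>

lemma wp_periodic_half:
  assumes a: "a \<in> \<Lambda>" "a / 2 \<notin> \<Lambda>" and z: "z \<notin> \<Lambda>"
  shows "wp (z + a) = wp z"
proof -
  have conn: "connected (- \<Lambda>)"
    using path_connected_complement_countable[OF _ \<Lambda>_countable] path_connected_imp_connected by auto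
  have "((\<lambda>z. wp (z + a) - wp z) has_field_derivative 0) (at w)" if "w \<in> - \<Lambda>" for w
  proof -
    have "(wp has_field_derivative wp_deriv (w + a)) (at (w + a))"
      using that a(1) by (intro wp_has_derivative) (auto simp: \<Lambda>_add_iff)
    hence "((\<lambda>z. wp (z + a)) has_field_derivative wp_deriv (w + a)) (at w)"
      by (simp only: DERIV_shift)
    hence "((\<lambda>z. wp (z + a) - wp z) has_field_derivative (wp_deriv (w + a) - wp_deriv w)) (at w)"
      using wp_has_derivative[of w] that by (intro DERIV_diff) auto
    thus ?thesis using wp_deriv_periodic[OF a(1)] by simp
  qed
  hence "(\<lambda>z. wp (z + a) - wp z) constant_on - \<Lambda>"
    using conn \<Lambda>_closed[of \<Lambda>] by (intro has_field_derivative_0_imp_constant_on) auto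
  then obtain c where c: "\<And>w. w \<notin> \<Lambda> \<Longrightarrow> wp (w + a) - wp w = c"
    unfolding constant_on_def by blast
  have "c = wp (- (a / 2) + a) - wp (- (a / 2))"
    using c[of "- (a / 2)"] a by simp
  also have "- (a / 2) + a = a / 2" by simp
  finally have "c = 0" using wp_even[of "a / 2"] by simp
  thus ?thesis using c[OF z] by simp
qed

lemma \<Lambda>_periodic_if:
  fixes f :: "complex \<Rightarrow> 'a"
  assumes "\<And>z. f (z + \<omega>1) = f z" "\<And>z. f (z + \<omega>2) = f z" and a: "a \<in> \<Lambda>"
  shows "f (z + a) = f z"
proof -
  have *: "f (z + of_int k * w) = f z" if "\<And>z. f (z + w) = f z" for w z k
  proof (induction k arbitrary: z rule: int_induct[where k = 0])
    case (step1 i)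
    show ?case using step1(2)[of "z"] that[of "z + of_int i * w"] by (simp add: algebra_simps)
  next
    case (step2 i)
    show ?case using step2(2)[of "z - w"] that[of "z - w"] by (simp add: algebra_simps)
  qed auto
  obtain m n :: int where "a = of_int m * \<omega>1 + of_int n * \<omega>2"
    using a by (auto simp: \<Lambda>_eq)
  thus ?thesis
    using *[OF assms(1), of "z + of_int n * \<omega>2" m] *[OF assms(2), of z n] by (simp add: algebra_simps)
qed

text \<open>The value 0 on the lattice replaces the junk values of the series, so that periodicity and
  parity hold without exceptional points.\<close>

definition P :: "complex \<Rightarrow> complex" where "P z = (if z \<in> \<Lambda> then 0 else wp z)"
definition P' :: "complex \<Rightarrow> complex" where "P' z = (if z \<in> \<Lambda> then 0 else wp_deriv z)"

text \<open>Elements such as 2 * \<omega>1 have their half in \<Lambda>, so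
  \<open>wp_periodic_half\<close> is applied to the two generators only and the other periods follow
  from these.\<close>

lemma P_periodic: "a \<in> \<Lambda> \<Longrightarrow> P (z + a) = P z"
proof (rule \<Lambda>_periodic_if)
  show "P (z + \<omega>1) = P z" "P (z + \<omega>2) = P z" for z
    by (auto simp: P_def \<Lambda>_add_iff \<Lambda>_\<omega>1 \<Lambda>_\<omega>2 wp_periodic_half half_period_notin)
qed

lemma P'_periodic: "a \<in> \<Lambda> \<Longrightarrow> P' (z + a) = P' z"
  by (auto simp: P'_def \<Lambda>_add_iff wp_deriv_periodic)

lemma P_even: "P (- z) = P z"
  by (simp add: P_def wp_even)

lemma P'_odd: "P' (- z) = - P' z"
proof (cases "z \<in> \<Lambda>")
  case False
  have "((\<lambda>z. wp (- z)) has_field_derivative (wp_deriv (- z) * (- 1))) (at z)"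
    using False by (intro DERIV_chain2[where f = wp] wp_has_derivative) (auto intro!: derivative_eq_intros)
  hence "wp_deriv (- z) * (- 1) = wp_deriv z"
    using wp_has_derivative[OF False] by (simp add: wp_even DERIV_unique)
  thus ?thesis using False by (simp add: P'_def minus_equation_iff)
qed (simp add: P'_def)

section \<open>Meromorphy of \<open>P\<close> and \<open>P'\<close>, and their leading terms at
  0\<close>

lemma open_Compl_\<Lambda>: "open (- \<Lambda>)"
  using \<Lambda>_closed[of \<Lambda>] by auto

lemma P_analytic: "z \<notin> \<Lambda> \<Longrightarrow> P analytic_on {z}"
proof -
  assume "z \<notin> \<Lambda>"
  have "wp holomorphic_on - \<Lambda>"
    using wp_has_derivative open_Compl_\<Lambda> by (auto simp: holomorphic_on_open)
  hence "P holomorphic_on - \<Lambda>" 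
    by (rule holomorphic_transform) (auto simp: P_def)
  thus ?thesis using \<open>z \<notin> \<Lambda>\<close> open_Compl_\<Lambda> analytic_at by blast
qed

lemma P_eq_wp: "eventually (\<lambda>w. P w = wp w) (at z)"
  using eventually_not_in_\<Lambda>[of z] by eventually_elim (auto simp: P_def)

lemma P'_eq_deriv_wp: "eventually (\<lambda>w. P' w = deriv wp w) (at z)"
  using eventually_not_in_\<Lambda>[of z]
  by eventually_elim (auto simp: P'_def DERIV_imp_deriv[OF wp_has_derivative])

lemma P'_eq_deriv_P: "eventually (\<lambda>w. P' w = deriv P w) (at z)"
  using eventually_not_in_\<Lambda>[of z]
proof eventually_elim
  case (elim w)
  \<comment> \<open>Comparing derivatives at w needs agreement on a full neighbourhood of w, which
    exists because the complement of \<Lambda> is open.\<close>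
  have "eventually (\<lambda>x. x \<in> - \<Lambda>) (nhds w)"
    using elim open_Compl_\<Lambda> by (intro eventually_nhds_in_open) auto
  hence "eventually (\<lambda>x. P x = wp x) (nhds w)"
    by eventually_elim (auto simp: P_def)
  hence "deriv P w = deriv wp w" by (intro deriv_cong_ev) auto
  thus ?case using elim by (auto simp: P'_def DERIV_imp_deriv[OF wp_has_derivative])
qed

text \<open>Carries meromorphy from the origin to every lattice point.\<close>

lemma periodic_meromorphic:
  assumes "\<And>z a. a \<in> \<Lambda> \<Longrightarrow> g (z + a) = g z" "g meromorphic_on {z}" "a \<in> \<Lambda>"
  shows "g meromorphic_on {z + a}"
proof -
  have "(\<lambda>w. g (w - a)) meromorphic_on {z + a}"
    using assms(2) by (rule meromorphic_on_compose) (auto intro!: analytic_intros)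
  moreover have "g (w - a) = g w" for w using assms(1)[OF assms(3), of "w - a"] by simp
  ultimately show ?thesis by simp
qed

lemma P_meromorphic: "P meromorphic_on A"
proof -
  have 0: "P meromorphic_on {0}"
  proof -
    have "(\<lambda>z. 1 / z ^ 2 + wp_reg z) meromorphic_on {0}"
      using analytic_on_imp_meromorphic_on[OF wp_reg_analytic_at_0] by (intro meromorphic_intros)
    also have "?this \<longleftrightarrow> P meromorphic_on {0}"
      using P_eq_wp by (intro meromorphic_on_cong[symmetric]) (auto simp: wp_eq)
    finally show ?thesis .
  qed
  have "P meromorphic_on {z}" for z
  proof (cases "z \<in> \<Lambda>")
    case True
    thus ?thesis using periodic_meromorphic[of P 0 z] 0 P_periodic by simp
  qed (simp add: P_analytic analytic_on_imp_meromorphic_on)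
  thus ?thesis using meromorphic_on_meromorphic_at by blast
qed

lemma P'_meromorphic: "P' meromorphic_on A"
proof -
  have "deriv P meromorphic_on A" by (intro meromorphic_intros P_meromorphic)
  also have "?this \<longleftrightarrow> P' meromorphic_on A"
    using P'_eq_deriv_P by (intro meromorphic_on_cong[symmetric]) auto
  finally show ?thesis .
qed

text \<open>Pole orders are recorded as limits of z ^ n times the function, the form in which
  leading terms are later cancelled.\<close>

lemma P_pole: "((\<lambda>z. z ^ 2 * P z) \<longlongrightarrow> 1) (at 0)"
proof -
  have "wp_reg \<midarrow>0\<rightarrow> wp_reg 0"
    using wp_reg_analytic_at_0 analytic_at_imp_isCont isContD by blast
  hence "((\<lambda>z. 1 + z ^ 2 * wp_reg z) \<longlongrightarrow> 1 + 0 ^ 2 * wp_reg 0) (at 0)"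
    by (intro tendsto_intros)
  moreover have "eventually (\<lambda>z. 1 + z ^ 2 * wp_reg z = z ^ 2 * P z) (at 0)"
    using P_eq_wp[of 0] eventually_neq_at_within[of 0 0]
    by eventually_elim (auto simp: wp_eq field_simps)
  ultimately show ?thesis by (auto intro: Lim_transform_eventually)
qed

lemma P'_pole: "((\<lambda>z. z ^ 3 * P' z) \<longlongrightarrow> -2) (at 0)"
proof -
  have "deriv wp_reg analytic_on {0}" using wp_reg_analytic_at_0 by (rule analytic_deriv)
  hence "deriv wp_reg \<midarrow>0\<rightarrow> deriv wp_reg 0"
    using analytic_at_imp_isCont isContD by blast
  hence "((\<lambda>z. -2 + z ^ 3 * deriv wp_reg z) \<longlongrightarrow> -2 + 0 ^ 3 * deriv wp_reg 0) (at 0)"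
    by (intro tendsto_intros)
  moreover have "eventually (\<lambda>z. -2 + z ^ 3 * deriv wp_reg z = z ^ 3 * P' z) (at 0)"
    using eventually_not_in_\<Lambda>[of 0]
  proof eventually_elim
    case (elim z)
    hence z: "z \<noteq> 0" "z \<notin> \<Lambda> - {0}" by auto
    obtain D where D: "(wp_reg has_field_derivative D) (at z)"
      using wp_reg_derivative[OF z(2)] .
    have "((\<lambda>z. 1 / z ^ 2 + wp_reg z) has_field_derivative (-2 / z ^ 3 + D)) (at z)"
      using z(1) by (auto intro!: derivative_eq_intros D simp: field_simps power2_eq_square power3_eq_cube)
    hence "wp_deriv z = -2 / z ^ 3 + D"
      using wp_has_derivative[OF elim] DERIV_unique by (simp add: wp_eq[abs_def])
    thus ?case using elim z(1) DERIV_imp_deriv[OF D] by (simp add: P'_def field_simps)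
  qed
  ultimately show ?thesis by (auto intro: Lim_transform_eventually)
qed

end

subsection \<open>Elliptic functions\<close>

lemma meromorphic_pole_order:
  assumes "g meromorphic_on {z}"
  obtains n c where "((\<lambda>w. (w - z) ^ n * g w) \<longlongrightarrow> c) (at z)"
proof (cases "is_pole g z")
  case False
  with assms obtain c where "g \<midarrow>z\<rightarrow> c"
    using meromorphic_on_not_essential not_essential_def by blast
  thus ?thesis using that[of 0] by simp
next
  case True
  obtain A where A: "open A" "z \<in> A" "g holomorphic_on A - {z}"
    using meromorphic_on_isolated_singularity[OF assms] isolated_singularity_at_iff_analytic_nhd
      analytic_imp_holomorphic by meson
  \<comment> \<open>At a pole, \<open>zor_poly\<close> is the holomorphic numerator over the power
    of w - z, so its value at z is the wanted limit.\<close>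
  obtain r where r: "r > 0" "zor_poly g z holomorphic_on cball z r"
      "\<And>w. w \<in> cball z r - {z} \<Longrightarrow> g w = zor_poly g z w / (w - z) ^ nat (- zorder g z)"
    using zorder_exist_pole[OF A(3,1,2) True] by blast
  have "continuous_on (ball z r) (zor_poly g z)"
    using r(2) holomorphic_on_imp_continuous_on continuous_on_subset ball_subset_cball by blast
  hence cont: "isCont (zor_poly g z) z"
    using r(1) by (simp add: continuous_on_eq_continuous_at)
  have "eventually (\<lambda>w. w \<in> ball z r - {z}) (at z)"
    using r(1) by (intro eventually_at_in_open) auto
  hence ev: "eventually (\<lambda>w. zor_poly g z w = (w - z) ^ nat (- zorder g z) * g w) (at z)"
    by eventually_elim (use r(3) in auto)
  show ?thesis by (rule that[OF Lim_transform_eventually[OF isContD[OF cont] ev]])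
qed

text \<open>After filling the singularity, z ^ (n + 1) * g z becomes an analytic F with F 0 = 0, so
  F w / w tends to the derivative of F at 0.\<close>

lemma meromorphic_lower_pole_order:
  assumes g: "g meromorphic_on {0}" and lim: "((\<lambda>z. z ^ Suc n * g z) \<longlongrightarrow> 0) (at 0)"
  obtains c where "((\<lambda>z. z ^ n * g z) \<longlongrightarrow> c) (at 0)"
proof -
  define u where "u = (\<lambda>z. z ^ Suc n * g z)"
  have iso: "isolated_singularity_at u 0"
    unfolding u_def by (intro meromorphic_on_isolated_singularity meromorphic_intros g)
  define F where "F = remove_sings u"
  have "F analytic_on {0}"
    unfolding F_def by (rule remove_sings_analytic_at[OF iso, of 0]) (use lim in \<open>simp add: u_def\<close>)
  then obtain D where "(F has_field_derivative D) (at 0)"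
    using analytic_on_imp_differentiable_at field_differentiable_def by blast
  moreover have "F 0 = 0" unfolding F_def using lim by (intro remove_sings_eqI) (simp add: u_def)
  ultimately have lim': "((\<lambda>w. F w / w) \<longlongrightarrow> D) (at 0)"
    by (simp add: has_field_derivative_iff)
  have ev: "eventually (\<lambda>w. F w / w = w ^ n * g w) (at 0)"
    using eventually_remove_sings_eq_at[OF iso] eventually_neq_at_within[of 0 0]
    by eventually_elim (simp add: F_def u_def)
  show ?thesis by (rule that[OF Lim_transform_eventually[OF lim' ev]])
qed

lemma eventually_cosparse_UNIV_iff:
  "eventually Q (cosparse UNIV) \<longleftrightarrow> (\<forall>x. eventually Q (at x))"
  by (simp add: eventually_cosparse_open_eq)

text \<open>Poles and filled-in values depend only on punctured neighbourhoods. Hence identities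
  between meromorphic functions need only be proved off a sparse set.\<close>

lemma cp1_map_cong:
  assumes "\<forall>\<^sub>\<approx>z\<in>UNIV. h z = k z"
  shows "cp1_map h = cp1_map k"
proof
  fix z
  have ev: "eventually (\<lambda>w. h w = k w) (at z)"
    using assms by (simp add: eventually_cosparse_UNIV_iff)
  show "cp1_map h z = cp1_map k z"
    using is_pole_cong[OF ev refl] remove_sings_cong[OF ev refl] by (simp add: cp1_map_def)
qed

lemma rational_function_poly_divide:
  "Q \<noteq> 0 \<Longrightarrow> rational_function (\<lambda>w. poly P w / poly Q w)"
  by (auto simp: rational_function_def)

section \<open>Closure properties of elliptic functions\<close>

context complex_lattice begin


text \<open>Periodicity is demanded at every point, poles included, so that it passes through the
  total arithmetic operations without exceptions.\<close>

definition elliptic :: "(complex \<Rightarrow> complex) \<Rightarrow> bool" where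
  "elliptic g \<longleftrightarrow> g meromorphic_on UNIV \<and> (\<forall>z. \<forall>a\<in>\<Lambda>. g (z + a) = g z)"

lemma elliptic_meromorphic: "elliptic g \<Longrightarrow> g meromorphic_on A"
  using meromorphic_on_subset by (auto simp: elliptic_def)

lemma elliptic_periodic: "elliptic g \<Longrightarrow> a \<in> \<Lambda> \<Longrightarrow> g (z + a) = g z"
  by (auto simp: elliptic_def)

lemma elliptic_P: "elliptic P"
  by (simp add: elliptic_def P_periodic P_meromorphic)

lemma elliptic_P': "elliptic P'"
  by (simp add: elliptic_def P'_periodic P'_meromorphic)

lemma elliptic_const: "elliptic (\<lambda>_. c)"
  by (auto simp: elliptic_def)

lemma elliptic_add: "elliptic f \<Longrightarrow> elliptic g \<Longrightarrow> elliptic (\<lambda>z. f z + g z)"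
  by (auto simp: elliptic_def intro!: meromorphic_intros)

lemma elliptic_diff: "elliptic f \<Longrightarrow> elliptic g \<Longrightarrow> elliptic (\<lambda>z. f z - g z)"
  by (auto simp: elliptic_def intro!: meromorphic_intros)

lemma elliptic_mult: "elliptic f \<Longrightarrow> elliptic g \<Longrightarrow> elliptic (\<lambda>z. f z * g z)"
  by (auto simp: elliptic_def intro!: meromorphic_intros)

lemma elliptic_divide: "elliptic f \<Longrightarrow> elliptic g \<Longrightarrow> elliptic (\<lambda>z. f z / g z)"
  by (auto simp: elliptic_def intro!: meromorphic_intros)

lemma elliptic_power: "elliptic f \<Longrightarrow> elliptic (\<lambda>z. f z ^ n)"
  by (auto simp: elliptic_def intro!: meromorphic_intros)

lemma elliptic_poly: "elliptic f \<Longrightarrow> elliptic (\<lambda>z. poly Q (f z))"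
  by (induction Q) (auto simp: elliptic_const intro!: elliptic_add elliptic_mult)

lemma elliptic_reflect:
  assumes "elliptic g"
  shows "elliptic (\<lambda>z. g (- z))"
proof -
  have "(\<lambda>z. g (- z)) meromorphic_on UNIV"
    using elliptic_meromorphic[OF assms, of UNIV]
    by (rule meromorphic_on_compose) (auto intro!: analytic_intros)
  moreover have "g (- (z + a)) = g (- z)" if "a \<in> \<Lambda>" for z a
    using elliptic_periodic[OF assms, of "- a" "- z"] that by simp
  ultimately show ?thesis by (auto simp: elliptic_def)
qed

section \<open>Liouville's theorem for elliptic functions\<close>

lemma elliptic_limit_translate:
  assumes "elliptic g" "a \<in> \<Lambda>" "g \<midarrow>z\<rightarrow> c"
  shows "g \<midarrow>z + a\<rightarrow> c"
proof -
  have "(\<lambda>w. g (w + (- a))) \<midarrow>z - (- a)\<rightarrow> c" using assms(3) by (rule LIM_offset)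
  thus ?thesis using elliptic_periodic[OF assms(1), of "- a"] assms(2) by simp
qed

text \<open>The closed period parallelogram: compactness matters, while uniqueness of
  representatives does not.\<close>

definition fundamental :: "complex set" where
  "fundamental = (\<lambda>(x, y). of_real x * \<omega>1 + of_real y * \<omega>2) ` (cbox (0, 0) (1, 1) :: (real \<times> real) set)"

lemma compact_fundamental: "compact fundamental"
  unfolding fundamental_def
  by (intro compact_continuous_image compact_cbox) (auto simp: case_prod_unfold intro!: continuous_intros)

lemma fundamental_representative:
  obtains a b where "a \<in> \<Lambda>" "b \<in> fundamental" "z = b + a"
proof -
  obtain x y :: real where z: "z = of_real x * \<omega>1 + of_real y * \<omega>2"
    using real_coordinates .
  show ?thesis
  proof (rule that)
    show "of_int \<lfloor>x\<rfloor> * \<omega>1 + of_int \<lfloor>y\<rfloor> * \<omega>2 \<in> \<Lambda>" by (auto simp: \<Lambda>_eq)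
    have "(frac x, frac y) \<in> cbox (0, 0) (1, 1)"
      by (auto simp: cbox_Pair_eq frac_lt_1 less_imp_le)
    thus "of_real (frac x) * \<omega>1 + of_real (frac y) * \<omega>2 \<in> fundamental"
      unfolding fundamental_def by (intro image_eqI[of _ _ "(frac x, frac y)"]) auto
    show "z = of_real (frac x) * \<omega>1 + of_real (frac y) * \<omega>2 + (of_int \<lfloor>x\<rfloor> * \<omega>1 + of_int \<lfloor>y\<rfloor> * \<omega>2)"
      by (simp add: z frac_def algebra_simps)
  qed
qed

text \<open>With its singularities filled in, g becomes entire and takes all its values on the
  compact parallelogram, so it is bounded. The original g may still deviate at removable
  singularities, hence equality off a sparse set.\<close>

lemma elliptic_without_poles_constant:
  assumes g: "elliptic g" and lim: "\<And>z. \<exists>c. g \<midarrow>z\<rightarrow> c"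
  obtains c where "\<forall>\<^sub>\<approx>z\<in>UNIV. g z = c"
proof -
  define h where "h = remove_sings g"
  have "h analytic_on {z}" for z
    using lim[of z] remove_sings_analytic_at meromorphic_on_isolated_singularity elliptic_meromorphic[OF g]
    unfolding h_def by blast
  hence hol: "h holomorphic_on UNIV"
    using analytic_imp_holomorphic analytic_on_analytic_at by blast
  have per: "h (z + a) = h z" if a: "a \<in> \<Lambda>" for z a
  proof -
    obtain c where "g \<midarrow>z\<rightarrow> c" using lim by blast
    moreover from this have "g \<midarrow>z + a\<rightarrow> c" using elliptic_limit_translate g a by blast
    ultimately show ?thesis unfolding h_def by (metis remove_sings_eqI)
  qed
  have "range h \<subseteq> h ` fundamental"
  proof safe
    fix z
    obtain a b where "a \<in> \<Lambda>" "b \<in> fundamental" "z = b + a"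
      using fundamental_representative .
    thus "h z \<in> h ` fundamental" using per by auto
  qed
  moreover have "compact (h ` fundamental)"
    using hol by (intro compact_continuous_image compact_fundamental)
      (auto intro: holomorphic_on_imp_continuous_on holomorphic_on_subset)
  ultimately have "bounded (range h)"
    using bounded_subset compact_imp_bounded by blast
  hence "remove_sings g constant_on UNIV"
    using Liouville_theorem[OF hol] by (simp add: h_def)
  thus ?thesis
    using that remove_sings_constant_on_open_iff[OF elliptic_meromorphic[OF g] open_UNIV] by blast
qed

section \<open>Even elliptic functions as rational functions of \<open>P\<close>\<close>

lemma P_limit: "z \<notin> \<Lambda> \<Longrightarrow> P \<midarrow>z\<rightarrow> P z"
  using P_analytic analytic_at_imp_isCont isContD by blast

text \<open>Induction on n, which is only an upper bound for the pole order at 0: the coefficient c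
  may vanish.\<close>

lemma even_elliptic_poly:
  assumes "elliptic g" "\<And>z. g (- z) = g z"
    and "\<And>z. z \<notin> \<Lambda> \<Longrightarrow> \<exists>c. g \<midarrow>z\<rightarrow> c"
    and "((\<lambda>z. z ^ n * g z) \<longlongrightarrow> c) (at 0)"
  shows "\<exists>T. \<forall>\<^sub>\<approx>z\<in>UNIV. g z = poly T (P z)"
  using assms
proof (induction n arbitrary: g c)
  case 0
  \<comment> \<open>For n = 0 the limit at 0 exists, and translation gives one at each lattice
    point.\<close>
  have "\<exists>c. g \<midarrow>z\<rightarrow> c" for z
  proof (cases "z \<in> \<Lambda>")
    case True
    thus ?thesis using elliptic_limit_translate[OF 0(1) True, of c 0] 0(4) by auto
  qed (use 0 in auto)
  then obtain d where "\<forall>\<^sub>\<approx>z\<in>UNIV. g z = d"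
    using elliptic_without_poles_constant[OF 0(1)] by blast
  thus ?case by (intro exI[of _ "[:d:]"]) simp
next
  case (Suc n)
  show ?case
  proof (cases "even (Suc n)")
    case True
    then obtain m where m: "Suc n = 2 * m" by blast
    \<comment> \<open>Since z ^ 2 * P z tends to 1, the subtracted term has leading term c / z ^ (2
      * m), which cancels that of g.\<close>
    define g1 where "g1 = (\<lambda>z. g z - c * P z ^ m)"
    have g1: "elliptic g1"
      unfolding g1_def by (intro elliptic_diff elliptic_mult elliptic_power elliptic_const elliptic_P Suc.prems)
    have "((\<lambda>z. z ^ Suc n * g z - c * (z ^ 2 * P z) ^ m) \<longlongrightarrow> c - c * 1 ^ m) (at 0)"
      by (intro tendsto_intros Suc.prems P_pole)
    moreover have "z ^ Suc n * g z - c * (z ^ 2 * P z) ^ m = z ^ Suc n * g1 z" for z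
      by (simp only: m g1_def power_mult power_mult_distrib) (simp only: algebra_simps)
    ultimately have "((\<lambda>z. z ^ Suc n * g1 z) \<longlongrightarrow> 0) (at 0)" by simp
    then obtain d where d: "((\<lambda>z. z ^ n * g1 z) \<longlongrightarrow> d) (at 0)"
      using meromorphic_lower_pole_order elliptic_meromorphic[OF g1] by blast
    have "\<exists>T. \<forall>\<^sub>\<approx>z\<in>UNIV. g1 z = poly T (P z)"
    proof (rule Suc.IH[OF g1 _ _ d])
      show "g1 (- z) = g1 z" for z using Suc.prems by (simp add: g1_def P_even)
      show "\<exists>c. g1 \<midarrow>z\<rightarrow> c" if z: "z \<notin> \<Lambda>" for z
      proof -
        obtain e where "g \<midarrow>z\<rightarrow> e" using Suc.prems z by blast
        hence "g1 \<midarrow>z\<rightarrow> e - c * P z ^ m"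
          unfolding g1_def by (intro tendsto_intros P_limit z)
        thus ?thesis by blast
      qed
    qed
    then obtain T where "\<forall>\<^sub>\<approx>z\<in>UNIV. g1 z = poly T (P z)" by blast
    hence "\<forall>\<^sub>\<approx>z\<in>UNIV. g z = poly (T + monom c m) (P z)"
      by eventually_elim (simp add: g1_def poly_monom algebra_simps)
    thus ?thesis by blast
  next
    case False
    \<comment> \<open>For odd exponent, substituting -z turns the limit c into -c by evenness of g,
      so c = 0 and the bound drops by itself.\<close>
    have "filterlim uminus (at (0 :: complex)) (at 0)"
      by (simp add: filterlim_def filtermap_at_minus)
    with Suc.prems(4) have "((\<lambda>z. (- z) ^ Suc n * g (- z)) \<longlongrightarrow> c) (at 0)"
      by (rule filterlim_compose)
    hence "((\<lambda>z. - (z ^ Suc n * g z)) \<longlongrightarrow> c) (at 0)"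
      using False Suc.prems(2) by (simp add: power_minus_odd del: power_Suc)
    hence "((\<lambda>z. z ^ Suc n * g z) \<longlongrightarrow> - c) (at 0)"
      using tendsto_minus by fastforce
    hence "c = - c" using Suc.prems(4) LIM_unique by blast
    hence "((\<lambda>z. z ^ Suc n * g z) \<longlongrightarrow> 0) (at 0)" using Suc.prems(4) by simp
    then obtain d where d: "((\<lambda>z. z ^ n * g z) \<longlongrightarrow> d) (at 0)"
      using meromorphic_lower_pole_order elliptic_meromorphic[OF Suc.prems(1)] by blast
    show ?thesis by (rule Suc.IH[OF Suc.prems(1-3) d])
  qed
qed

text \<open>A meromorphic function on the plane is constant or avoids r, in both cases off a sparse
  set; the pole at 0 excludes the constant.\<close>

lemma P_avoids: "\<forall>\<^sub>\<approx>z\<in>UNIV. P z \<noteq> r"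
proof -
  have "\<not> (\<forall>\<^sub>\<approx>z\<in>UNIV. P z = r)"
  proof
    assume "\<forall>\<^sub>\<approx>z\<in>UNIV. P z = r"
    hence "eventually (\<lambda>z. z ^ 2 * P z = z ^ 2 * r) (at 0)"
      unfolding eventually_cosparse_UNIV_iff by (auto elim!: allE[of _ 0] eventually_mono)
    hence "((\<lambda>z. z ^ 2 * r) \<longlongrightarrow> 1) (at 0)"
      by (rule Lim_transform_eventually[OF P_pole])
    moreover have "((\<lambda>z. z ^ 2 * r) \<longlongrightarrow> 0 ^ 2 * r) (at 0)" by (intro tendsto_intros)
    ultimately show False using LIM_unique by fastforce
  qed
  thus ?thesis
    using meromorphic_imp_constant_or_avoid[OF P_meromorphic open_UNIV connected_UNIV] by blast
qed

lemma P'_nonzero: "\<forall>\<^sub>\<approx>z\<in>UNIV. P' z \<noteq> 0"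
proof -
  have "\<not> (\<forall>\<^sub>\<approx>z\<in>UNIV. P' z = 0)"
  proof
    assume "\<forall>\<^sub>\<approx>z\<in>UNIV. P' z = 0"
    hence "eventually (\<lambda>z. z ^ 3 * P' z = 0) (at 0)"
      unfolding eventually_cosparse_UNIV_iff by (auto elim!: allE[of _ 0] eventually_mono)
    from Lim_transform_eventually[OF P'_pole this]
    show False by (simp add: tendsto_const_iff)
  qed
  thus ?thesis
    using meromorphic_imp_constant_or_avoid[OF P'_meromorphic open_UNIV connected_UNIV] by blast
qed

lemma poly_P_nonzero:
  assumes "Q \<noteq> 0"
  shows "\<forall>\<^sub>\<approx>z\<in>UNIV. poly Q (P z) \<noteq> 0"
proof -
  have "eventually (\<lambda>z. \<forall>r\<in>{r. poly Q r = 0}. P z \<noteq> r) (cosparse UNIV)"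
    using poly_roots_finite[OF assms] P_avoids by (intro eventually_ball_finite) auto
  thus ?thesis by eventually_elim auto
qed

text \<open>Multiplying by a power of \<open>P z - P b\<close>, which vanishes at \<open>b\<close>, removes the pole at \<open>b\<close>;
  only finitely many poles have to be treated modulo the lattice.\<close>

lemma clear_poles:
  assumes g: "elliptic g"
  shows "\<exists>Q. Q \<noteq> 0 \<and> (\<forall>z. z \<notin> \<Lambda> \<longrightarrow> (\<exists>c. (\<lambda>z. poly Q (P z) * g z) \<midarrow>z\<rightarrow> c))"
proof -
  \<comment> \<open>Poles form a sparse set, so a compact set meets only finitely many. Lattice
    points are left out because \<open>P\<close> itself has poles there.\<close>
  define B where "B = {b \<in> fundamental - \<Lambda>. is_pole g b}"
  have "{z. is_pole g z} sparse_in UNIV"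
    using meromorphic_on_imp_not_pole_cosparse[OF elliptic_meromorphic[OF g], of UNIV]
    by (simp add: eventually_cosparse)
  hence "finite (fundamental \<inter> {z. is_pole g z})"
    using sparse_in_compact_finite compact_fundamental sparse_in_subset by blast
  hence B: "finite B" by (rule rev_finite_subset) (auto simp: B_def)
  have "\<forall>b. \<exists>n. \<exists>c. ((\<lambda>w. (w - b) ^ n * g w) \<longlongrightarrow> c) (at b)"
    using meromorphic_pole_order[OF elliptic_meromorphic[OF g]] by blast
  then obtain n where n: "\<And>b. \<exists>c. ((\<lambda>w. (w - b) ^ n b * g w) \<longlongrightarrow> c) (at b)"
    using choice[of "\<lambda>b n. \<exists>c. ((\<lambda>w. (w - b) ^ n * g w) \<longlongrightarrow> c) (at b)"] by blast
  \<comment> \<open>Different b may share the value \<open>P b\<close>; the factor is then merely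
    repeated, and Q remains a nonzero polynomial.\<close>
  define Q where "Q = (\<Prod>b\<in>B. [:- P b, 1:] ^ n b)"
  have lim: "\<exists>c. (\<lambda>z. poly Q (P z) * g z) \<midarrow>b\<rightarrow> c" if b: "b \<in> fundamental" "b \<notin> \<Lambda>" for b
  proof (cases "is_pole g b")
    case False
    then obtain c where "g \<midarrow>b\<rightarrow> c"
      using meromorphic_on_not_essential[OF elliptic_meromorphic[OF g]] not_essential_def by blast
    hence "(\<lambda>z. poly Q (P z) * g z) \<midarrow>b\<rightarrow> poly Q (P b) * c"
      by (intro tendsto_intros P_limit b)
    thus ?thesis by blast
  next
    case True
    hence bB: "b \<in> B" using b by (auto simp: B_def)
    define Q' where "Q' = (\<Prod>b\<in>B - {b}. [:- P b, 1:] ^ n b)"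
    have Q: "Q = [:- P b, 1:] ^ n b * Q'"
      unfolding Q_def Q'_def using B bB by (rule prod.remove)
    obtain c where c: "((\<lambda>w. (w - b) ^ n b * g w) \<longlongrightarrow> c) (at b)" using n by blast
    obtain D where "(P has_field_derivative D) (at b)"
      using P_analytic[OF b(2)] analytic_on_imp_differentiable_at field_differentiable_def by blast
    hence D: "((\<lambda>w. (P w - P b) / (w - b)) \<longlongrightarrow> D) (at b)"
      by (simp add: has_field_derivative_iff)
    \<comment> \<open>The power of w - b is divided out of the factor of Q at b and handed to g, so
      that each of the three factors has a limit.\<close>
    have 1: "((\<lambda>w. ((P w - P b) / (w - b)) ^ n b * poly Q' (P w) * ((w - b) ^ n b * g w))
             \<longlongrightarrow> D ^ n b * poly Q' (P b) * c) (at b)"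
      by (intro tendsto_intros D c P_limit b)
    have 2: "eventually (\<lambda>w. ((P w - P b) / (w - b)) ^ n b * poly Q' (P w) * ((w - b) ^ n b * g w)
          = poly Q (P w) * g w) (at b)"
      using eventually_neq_at_within[of b b]
      by eventually_elim (simp add: Q power_divide)
    show ?thesis using Lim_transform_eventually[OF 1 2] by blast
  qed
  show ?thesis
  proof (intro exI[of _ Q] conjI allI impI)
    show "Q \<noteq> 0" using B by (simp add: Q_def)
    show "\<exists>c. (\<lambda>z. poly Q (P z) * g z) \<midarrow>z\<rightarrow> c" if z: "z \<notin> \<Lambda>" for z
    proof -
      obtain a b where ab: "a \<in> \<Lambda>" "b \<in> fundamental" "z = b + a"
        using fundamental_representative .
      hence "b \<notin> \<Lambda>" using z \<Lambda>_add by blast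
      then obtain c where "(\<lambda>z. poly Q (P z) * g z) \<midarrow>b\<rightarrow> c" using lim ab by blast
      moreover have "elliptic (\<lambda>z. poly Q (P z) * g z)"
        by (intro elliptic_mult elliptic_poly elliptic_P g)
      ultimately show ?thesis using elliptic_limit_translate ab by blast
    qed
  qed
qed

lemma even_elliptic_rational:
  assumes g: "elliptic g" and even: "\<And>z. g (- z) = g z"
  obtains R where "rational_function R" "\<forall>\<^sub>\<approx>z\<in>UNIV. g z = R (P z)"
proof -
  obtain Q where Q: "Q \<noteq> 0" "\<And>z. z \<notin> \<Lambda> \<Longrightarrow> \<exists>c. (\<lambda>z. poly Q (P z) * g z) \<midarrow>z\<rightarrow> c"
    using clear_poles[OF g] by blast
  let ?g = "\<lambda>z. poly Q (P z) * g z"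
  have ell: "elliptic ?g" by (intro elliptic_mult elliptic_poly elliptic_P g)
  obtain n c where "((\<lambda>w. (w - 0) ^ n * ?g w) \<longlongrightarrow> c) (at 0)"
    using meromorphic_pole_order[OF elliptic_meromorphic[OF ell]] .
  hence nc: "((\<lambda>w. w ^ n * ?g w) \<longlongrightarrow> c) (at 0)" by simp
  have "\<exists>T. \<forall>\<^sub>\<approx>z\<in>UNIV. ?g z = poly T (P z)"
    by (rule even_elliptic_poly[OF ell _ Q(2) nc]) (simp_all add: P_even even)
  then obtain T where "\<forall>\<^sub>\<approx>z\<in>UNIV. ?g z = poly T (P z)" by blast
  hence "\<forall>\<^sub>\<approx>z\<in>UNIV. g z = poly T (P z) / poly Q (P z)"
    using poly_P_nonzero[OF Q(1)] by eventually_elim (simp add: field_simps)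
  thus ?thesis using that rational_function_poly_divide[OF Q(1)] by blast
qed

section \<open>The field of elliptic functions\<close>

theorem elliptic_function_field:
  assumes g: "elliptic g"
  obtains R S where "rational_function R" "rational_function S"
    "\<forall>\<^sub>\<approx>z\<in>UNIV. g z = R (P z) + S (P z) * P' z"
proof -
  have "elliptic (\<lambda>z. (g z + g (- z)) / 2)"
    by (intro elliptic_divide elliptic_add elliptic_reflect[OF g] elliptic_const g)
  then obtain R where R: "rational_function R" "\<forall>\<^sub>\<approx>z\<in>UNIV. (g z + g (- z)) / 2 = R (P z)"
    by (rule even_elliptic_rational) (simp add: add.commute)
  \<comment> \<open>A quotient of two odd functions is even. Multiplying back by \<open>P'\<close>
    is legitimate only where \<open>P'\<close> is nonzero, that is off a sparse set.\<close>
  have "elliptic (\<lambda>z. (g z - g (- z)) / 2 / P' z)"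
    by (intro elliptic_divide elliptic_diff elliptic_reflect[OF g] elliptic_const elliptic_P' g)
  then obtain S where S: "rational_function S" "\<forall>\<^sub>\<approx>z\<in>UNIV. (g z - g (- z)) / 2 / P' z = S (P z)"
    by (rule even_elliptic_rational) (simp add: P'_odd diff_divide_distrib)
  have "\<forall>\<^sub>\<approx>z\<in>UNIV. g z = R (P z) + S (P z) * P' z"
    using R(2) S(2) P'_nonzero
  proof eventually_elim
    case (elim z)
    have "S (P z) * P' z = (g z - g (- z)) / 2 / P' z * P' z"
      by (simp only: elim(2))
    also have "\<dots> = (g z - g (- z)) / 2"
      using elim(3) by simp
    finally have "R (P z) + S (P z) * P' z = (g z + g (- z)) / 2 + (g z - g (- z)) / 2"
      by (simp only: elim(1))
    also have "\<dots> = g z"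
      by (simp add: field_simps)
    finally show ?case ..
  qed
  thus ?thesis using that R S by blast
qed

end

section \<open>From invariant maps into the projective line to elliptic functions\<close>

theorem corollary4:
  fixes G :: "(complex \<Rightarrow> complex) set"
    and \<omega>1 \<omega>2 :: complex
    and f :: "complex \<Rightarrow> cp1"
  assumes "wallpaper_group G"
    and "(\<lambda>z. z + \<omega>1) \<in> G" and "(\<lambda>z. z + \<omega>2) \<in> G"
    and "\<omega>1 \<noteq> 0" and "\<omega>2 \<noteq> 0" and "\<omega>1 / \<omega>2 \<notin> \<real>"
    and "meromorphic_cp1 f"
    and "\<forall>g\<in>G. \<forall>z. f (g z) = f z"
  shows "let p = weierstrass_p (lattice_of \<omega>1 \<omega>2) in
           \<exists>R S. rational_function R \<and> rational_function S \<and>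
             f = cp1_map (\<lambda>z. R (p z) + S (p z) * deriv p z)"
proof -
  interpret complex_lattice \<omega>1 \<omega>2 by unfold_locales fact
  obtain h where h: "h meromorphic_on UNIV" "f = cp1_map h"
    using assms(7) by (auto simp: meromorphic_cp1_def)
  \<comment> \<open>Unlike h, this function is determined by f: it is the finite value of f, and 0
    where f is infinite, the value \<open>remove_sings\<close> takes at poles. Invariance of f
    therefore gives periodicity of g at every point.\<close>
  define g where "g = remove_sings h"
  have "g (z + w) = g z" if "(\<lambda>z. z + w) \<in> G" for z w
  proof -
    have "f (z + w) = f z"
      using bspec[OF assms(8) that] by simp
    thus ?thesis unfolding h(2)
      by (auto simp: cp1_map_def g_def split: if_splits)
  qed
  hence "elliptic g"
    using assms(2,3) \<Lambda>_periodic_if[of g] h(1) by (auto simp: elliptic_def g_def intro: remove_sings_meromorphic)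
  then obtain R S where RS: "rational_function R" "rational_function S"
    and g: "\<forall>\<^sub>\<approx>z\<in>UNIV. g z = R (P z) + S (P z) * P' z"
    by (rule elliptic_function_field)
  \<comment> \<open>The adjusted values on the lattice, and those of g where it differs from h, sit
    on sparse sets and are invisible to \<open>cp1_map\<close>.\<close>
  have "\<forall>\<^sub>\<approx>z\<in>UNIV. P z = wp z" "\<forall>\<^sub>\<approx>z\<in>UNIV. P' z = deriv wp z"
    by (simp_all add: eventually_cosparse_UNIV_iff P_eq_wp P'_eq_deriv_wp)
  hence "\<forall>\<^sub>\<approx>z\<in>UNIV. h z = R (wp z) + S (wp z) * deriv wp z"
    using g eventually_remove_sings_eq[OF h(1)] by eventually_elim (simp add: g_def)
  hence "f = cp1_map (\<lambda>z. R (wp z) + S (wp z) * deriv wp z)"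
    unfolding h(2) by (rule cp1_map_cong)
  thus ?thesis using RS by (auto simp: Let_def wp_def \<Lambda>_def)
qed

end
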